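(* There exists an absolute constant $c>0$ such that for all integers $D\ge 1$ there exist bipartite graphs $G$ and $H$ with bipartitions $(A_G,B_G)$ and $(A_H,B_H)$, respectively, such that $H$ is a bipartite correspondence-cover of $G$ with respect to some $L: A_G\to 2^{A_H},\ B_G\to 2^{B_H}$ and such that the following holds: the maximum degree of $H$ is at most $D$, $|L(v)| \ge c\,D^{8/5}$ for all $v\in A_G$, $|L(w)|=2$ for all $w\in B_G$, and $H$ does not admit an independent transversal with respect to $L$.
   Context: Graphs are simple and undirected. Let $G$ and $H$ be bipartite graphs with bipartitions $(A_G,B_G)$ and $(A_H,B_H)$. $H$ is a bipartite cover of $G$ with respect to a mapping $L:V(G)\to 2^{V(H)}$ if: (a) $L$ induces a partition of $V(H)$, i.e. the sets $L(v)$, $v\in V(G)$, are nonempty, pairwise disjoint and have union $V(H)$, and there are no edges of $H$ between $L(v)$ and $L(v')$ whenever $vv'\notin E(G)$; and (b) the sets $L(v)$, $v\in A_G$, partition $A_H$ and the sets $L(w)$, $w\in B_G$, partition $B_H$ (this is what is meant by writing $L: A_G\to 2^{A_H}, B_G\to 2^{B_H}$). It is a bipartite correspondence-cover if, in addition, for each edge $vv'\in E(G)$ the subgraph of $H$ between $L(v)$ and $L(v')$ is a matching (not necessarily perfect, possibly empty). An independent transversal of $H$ with respect to $L$ is an independent set of $H$ that contains exactly one vertex of each $L(v)$, $v\in V(G)$. *)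

theory Defs
  imports Complex_Main "HOL-Library.Disjoint_Sets" "Graph_Theory.Pair_Digraph"
begin

text \<open>
  A finite simple undirected graph is a \<^locale>\<open>pair_graph\<close>: a finite, loop-free, symmetric
  digraph whose arcs are pairs of vertices. The undirected edge \<open>uv\<close> is represented by the two
  arcs \<open>(u, v)\<close> and \<open>(v, u)\<close>, so the degree of a vertex is its \<^const>\<open>out_degree\<close>.
\<close>

definition bipartite_graph :: "'a pair_pre_digraph \<Rightarrow> 'a set \<Rightarrow> 'a set \<Rightarrow> bool" where
  "bipartite_graph G A B \<longleftrightarrow>
     pair_graph G \<and> A \<union> B = pverts G \<and> A \<inter> B = {} \<and>
     (\<forall>(u, v) \<in> parcs G. (u \<in> A \<and> v \<in> B) \<or> (u \<in> B \<and> v \<in> A))"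

definition max_degree_le :: "'a pair_pre_digraph \<Rightarrow> nat \<Rightarrow> bool" where
  "max_degree_le G D \<longleftrightarrow> (\<forall>v \<in> pverts G. out_degree (with_proj G) v \<le> D)"

text \<open>
  The sets \<open>L v\<close> are indexed by vertices, and distinct vertices must have disjoint sets; a
  statement about the image \<open>L ` I\<close> alone would not exclude \<open>L v = L w\<close> for \<open>v \<noteq> w\<close>.
\<close>

definition indexed_partition :: "('v \<Rightarrow> 'a set) \<Rightarrow> 'v set \<Rightarrow> 'a set \<Rightarrow> bool" where
  "indexed_partition L I X \<longleftrightarrow>
     (\<forall>v \<in> I. L v \<noteq> {}) \<and> disjoint_family_on L I \<and> (\<Union>v \<in> I. L v) = X"

text \<open>
  Only the arcs directed from \<open>X\<close> to \<open>Y\<close> are taken, so for disjoint \<open>X\<close> and \<open>Y\<close> every undirected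
  edge between them is represented exactly once.
\<close>

definition edges_between :: "'a pair_pre_digraph \<Rightarrow> 'a set \<Rightarrow> 'a set \<Rightarrow> ('a \<times> 'a) set" where
  "edges_between G X Y = parcs G \<inter> X \<times> Y"

definition is_matching :: "('a \<times> 'a) set \<Rightarrow> bool" where
  "is_matching M \<longleftrightarrow>
     (\<forall>e \<in> M. \<forall>f \<in> M. e \<noteq> f \<longrightarrow> {fst e, snd e} \<inter> {fst f, snd f} = {})"

definition bipartite_cover ::
  "'v pair_pre_digraph \<Rightarrow> 'v set \<Rightarrow> 'v set \<Rightarrow> 'a pair_pre_digraph \<Rightarrow> 'a set \<Rightarrow> 'a set \<Rightarrow>
   ('v \<Rightarrow> 'a set) \<Rightarrow> bool" where
  "bipartite_cover G A\<^sub>G B\<^sub>G H A\<^sub>H B\<^sub>H L \<longleftrightarrow>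
     bipartite_graph G A\<^sub>G B\<^sub>G \<and> bipartite_graph H A\<^sub>H B\<^sub>H \<and>
     indexed_partition L (pverts G) (pverts H) \<and>
     (\<forall>v \<in> pverts G. \<forall>v' \<in> pverts G. (v, v') \<notin> parcs G \<longrightarrow> edges_between H (L v) (L v') = {}) \<and>
     indexed_partition L A\<^sub>G A\<^sub>H \<and> indexed_partition L B\<^sub>G B\<^sub>H"

definition bipartite_correspondence_cover ::
  "'v pair_pre_digraph \<Rightarrow> 'v set \<Rightarrow> 'v set \<Rightarrow> 'a pair_pre_digraph \<Rightarrow> 'a set \<Rightarrow> 'a set \<Rightarrow>
   ('v \<Rightarrow> 'a set) \<Rightarrow> bool" where
  "bipartite_correspondence_cover G A\<^sub>G B\<^sub>G H A\<^sub>H B\<^sub>H L \<longleftrightarrow>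
     bipartite_cover G A\<^sub>G B\<^sub>G H A\<^sub>H B\<^sub>H L \<and>
     (\<forall>(v, v') \<in> parcs G. is_matching (edges_between H (L v) (L v')))"

definition independent_set :: "'a pair_pre_digraph \<Rightarrow> 'a set \<Rightarrow> bool" where
  "independent_set H S \<longleftrightarrow> S \<subseteq> pverts H \<and> (\<forall>x \<in> S. \<forall>y \<in> S. (x, y) \<notin> parcs H)"

definition independent_transversal ::
  "'v pair_pre_digraph \<Rightarrow> 'a pair_pre_digraph \<Rightarrow> ('v \<Rightarrow> 'a set) \<Rightarrow> 'a set \<Rightarrow> bool" where
  "independent_transversal G H L S \<longleftrightarrow>
     independent_set H S \<and> (\<forall>v \<in> pverts G. \<exists>!x. x \<in> S \<inter> L v)"

end

theory Submission
  imports Defs "HOL-Real_Asymp.Real_Asymp"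
begin

text \<open>
  A vertex \<open>w\<close> with \<open>L w = {w\<^sub>0, w\<^sub>1}\<close> obstructs a choice of one vertex from every list on the
  other side as soon as both \<open>w\<^sub>0\<close> and \<open>w\<^sub>1\<close> have a chosen neighbour. So the lists
  over \<open>A\<^sub>G\<close> can be thought of as \<open>n\<close> copies of \<open>{..<k}\<close>, and the vertices of \<open>B\<^sub>H\<close> as
  bins that come in pairs; a transversal is a choice \<open>a v < k\<close> that never puts a ball into both bins
  of a pair.

  The bins are organised in \<open>R\<close> rounds of \<open>m\<close> pairs each. In round \<open>r\<close>, part \<open>v\<close> throws its chosen
  element \<open>x\<close> into bin \<open>p v r x\<close>, with \<open>p v r\<close> injective. This gives every list element exactly one
  neighbour per round, so degree \<open>R\<close>; it gives every bin at most one neighbour per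
  part, so degree at most \<open>n\<close>; and injectivity is the matching condition. Lemma
  \<open>cover_of_placement\<close> turns such placements into a cover.

  With \<open>k = 2m\<close> take \<open>p v r x = (s r v + x) mod k\<close> for random shifts \<open>s r v\<close> and \<open>R = n\<close> rounds.
  For a fixed choice \<open>a\<close>, each round throws \<open>n\<close> balls independently and uniformly into \<open>k\<close> bins.
  If a throw avoids all collisions with probability below \<open>1 / k\<close>, then all \<open>n\<close> rounds do so with
  probability below \<open>k\<^bsup>-n\<^esup>\<close>, and a union bound over the \<open>k\<^sup>n\<close> choices leaves shifts
  for which every choice is obstructed (\<open>exists_colliding_shifts\<close>).

  The collision probability is a birthday estimate. Throw the balls in two halves of size \<open>h\<close>.
  Either the first half occupies fewer than \<open>q\<close> bins, which is rare, or each ball of the second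
  half must avoid at least \<open>q\<close> partner bins, which has probability at most
  \<open>(1 - q / k)\<^sup>h \<le> exp (- q h / k)\<close> (\<open>card_collision_free_le\<close>). With \<open>h = s\<^sup>5\<close>, \<open>k = 2 s\<^sup>8\<close>
  and \<open>q = s\<^sup>4\<close> the exponent is \<open>- s / 2\<close>, which beats the polynomial factor \<open>k\<close> once \<open>s\<close> is large
  (\<open>few_collision_free\<close>). Choosing \<open>s\<close> maximal with \<open>n = 2 s\<^sup>5 \<le> D\<close> yields lists of size
  \<open>2 s\<^sup>8\<close>, of order \<open>D\<^bsup>8/5\<^esup>\<close>; the remaining bounded values of \<open>D\<close> are absorbed
  into the constant by an example with lists of size one.
\<close>

section \<open>Covers from placements into paired bins\<close>

abbreviation symmetric_graph :: "'a set \<Rightarrow> ('a \<times> 'a) set \<Rightarrow> 'a pair_pre_digraph" where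
  "symmetric_graph V E \<equiv> \<lparr>pverts = V, parcs = E \<union> E\<inverse>\<rparr>"

lemma bipartite_symmetric_graph:
  assumes "finite A" "finite B" "A \<inter> B = {}" "E \<subseteq> A \<times> B"
  shows "bipartite_graph (symmetric_graph (A \<union> B) E) A B"
proof -
  have "finite E"
    using assms finite_subset by blast
  with assms have "pair_graph (symmetric_graph (A \<union> B) E)"
    by unfold_locales (auto simp: symmetric_def sym_def)
  with assms show ?thesis
    by (auto simp: bipartite_graph_def)
qed

lemma max_degree_symmetric_graph:
  assumes "A \<inter> B = {}" "E \<subseteq> A \<times> B"
    and "\<And>a. a \<in> A \<Longrightarrow> card (E `` {a}) \<le> D"
    and "\<And>b. b \<in> B \<Longrightarrow> card (E\<inverse> `` {b}) \<le> D"
  shows "max_degree_le (symmetric_graph (A \<union> B) E) D"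
  unfolding max_degree_le_def
proof
  fix u assume u: "u \<in> pverts (symmetric_graph (A \<union> B) E)"
  have out: "out_arcs (with_proj (symmetric_graph (A \<union> B) E)) u = Pair u ` ((E \<union> E\<inverse>) `` {u})"
    by (auto simp: out_arcs_def)
  have "(E \<union> E\<inverse>) `` {u} = (if u \<in> A then E `` {u} else E\<inverse> `` {u})"
    using assms(1,2) by auto
  with u assms(3,4) have "card ((E \<union> E\<inverse>) `` {u}) \<le> D"
    by auto
  then show "out_degree (with_proj (symmetric_graph (A \<union> B) E)) u \<le> D"
    by (simp add: out_degree_def out card_image inj_on_def)
qed

lemma is_matching_image:
  assumes "M \<subseteq> (\<lambda>x. (f x, g x)) ` X" "inj_on f X" "inj_on g X" "f ` X \<inter> g ` X = {}"
  shows "is_matching M"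
  unfolding is_matching_def
proof (intro ballI impI)
  fix e e' assume "e \<in> M" "e' \<in> M" "e \<noteq> e'"
  with assms(1) obtain x y where xy: "x \<in> X" "y \<in> X" "e = (f x, g x)" "e' = (f y, g y)" "x \<noteq> y"
    by blast
  have "f x \<noteq> f y" "g x \<noteq> g y"
    using xy assms(2,3) by (auto dest: inj_onD)
  moreover have "f x \<noteq> g y" "f y \<noteq> g x"
    using xy assms(4) by blast+
  ultimately show "{fst e, snd e} \<inter> {fst e', snd e'} = {}"
    using xy by auto
qed

text \<open>
  The graph \<open>G\<close> is complete bipartite between the parts \<open>v < n\<close> and the pairs \<open>(r, j)\<close>, and the list
  of \<open>(r, j)\<close> consists of the bins \<open>2 j\<close> and \<open>2 j + 1\<close> of round \<open>r\<close>. A collision in that pair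
  leaves no member of the list independent of the chosen elements. The list size \<open>k\<close>
  may be smaller than the number \<open>2 m\<close> of bins, which allows lists of size one.
\<close>
lemma cover_of_placement:
  fixes p :: "nat \<Rightarrow> nat \<Rightarrow> nat \<Rightarrow> nat"
  assumes "k \<ge> 1" "R \<le> D"
    and inj: "\<And>v r. v < n \<Longrightarrow> r < R \<Longrightarrow> inj_on (p v r) {..<k}"
    and slot: "\<And>v r x. v < n \<Longrightarrow> r < R \<Longrightarrow> x < k \<Longrightarrow> p v r x < 2 * m"
    and load: "\<And>r y. r < R \<Longrightarrow> y < 2 * m \<Longrightarrow> card {v. v < n \<and> y \<in> p v r ` {..<k}} \<le> D"
    and collision: "\<And>a. (\<And>v. v < n \<Longrightarrow> a v < k) \<Longrightarrow>
      \<exists>r<R. \<exists>j<m. \<exists>v<n. \<exists>v'<n. p v r (a v) = 2 * j \<and> p v' r (a v') = 2 * j + 1"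
  shows "\<exists>(G :: nat pair_pre_digraph) A\<^sub>G B\<^sub>G (H :: nat pair_pre_digraph) A\<^sub>H B\<^sub>H L.
    bipartite_correspondence_cover G A\<^sub>G B\<^sub>G H A\<^sub>H B\<^sub>H L \<and> max_degree_le H D \<and>
    (\<forall>v \<in> A\<^sub>G. card (L v) = k) \<and> (\<forall>w \<in> B\<^sub>G. card (L w) = 2) \<and>
    \<not> (\<exists>S. independent_transversal G H L S)"
proof -
  \<comment> \<open>All vertices have to be natural numbers; encoding tagged indices keeps the two sides apart.\<close>
  define gA where "gA v = to_nat (Inl v :: nat + nat \<times> nat)" for v
  define gB where "gB r j = to_nat (Inr (r, j) :: nat + nat \<times> nat)" for r j
  define hA where "hA v x = to_nat (Inl (v, x) :: nat \<times> nat + nat \<times> nat)" for v x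
  define hB where "hB r y = to_nat (Inr (r, y) :: nat \<times> nat + nat \<times> nat)" for r y
  have g_eq [simp]: "gA v = gA v' \<longleftrightarrow> v = v'" "gB r j = gB r' j' \<longleftrightarrow> r = r' \<and> j = j'"
    "gA v \<noteq> gB r j" "gB r j \<noteq> gA v" for v v' r r' j j'
    by (auto simp: gA_def gB_def)
  have h_eq [simp]: "hA v x = hA v' x' \<longleftrightarrow> v = v' \<and> x = x'"
    "hB r y = hB r' y' \<longleftrightarrow> r = r' \<and> y = y'" "hA v x \<noteq> hB r y" "hB r y \<noteq> hA v x"
    for v v' x x' r r' y y'
    by (auto simp: hA_def hB_def)
  define AG where "AG = gA ` {..<n}"
  define BG where "BG = (\<Union>r<R. gB r ` {..<m})"
  define AH where "AH = (\<Union>v<n. hA v ` {..<k})"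
  define BH where "BH = (\<Union>r<R. hB r ` {..<2 * m})"
  define E where "E = {(hA v x, hB r (p v r x)) | v x r. v < n \<and> x < k \<and> r < R}"
  define L where "L u = (case from_nat u :: nat + nat \<times> nat of
      Inl v \<Rightarrow> hA v ` {..<k} | Inr (r, j) \<Rightarrow> {hB r (2 * j), hB r (2 * j + 1)})" for u
  define G where "G = symmetric_graph (AG \<union> BG) (AG \<times> BG)"
  define H where "H = symmetric_graph (AH \<union> BH) E"
  have L_gA: "L (gA v) = hA v ` {..<k}" for v
    by (simp add: L_def gA_def)
  have L_gB: "L (gB r j) = {hB r (2 * j), hB r (2 * j + 1)}" for r j
    by (simp add: L_def gB_def)
  have E_sub: "E \<subseteq> AH \<times> BH"
    using slot by (auto simp: E_def AH_def BH_def)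
  have disj: "AG \<inter> BG = {}" "AH \<inter> BH = {}"
    by (auto simp: AG_def BG_def AH_def BH_def)
  have bipG: "bipartite_graph G AG BG" and bipH: "bipartite_graph H AH BH"
    unfolding G_def H_def using disj E_sub
    by (auto intro!: bipartite_symmetric_graph simp: AG_def BG_def AH_def BH_def)
  have partA: "indexed_partition L AG AH"
    using \<open>k \<ge> 1\<close>
    by (auto simp: indexed_partition_def disjoint_family_on_def AG_def AH_def L_gA lessThan_empty_iff)
  have union_B: "(\<Union>w \<in> BG. L w) = BH"
  proof
    show "(\<Union>w \<in> BG. L w) \<subseteq> BH"
      by (auto simp: BG_def BH_def L_gB)
    show "BH \<subseteq> (\<Union>w \<in> BG. L w)"
    proof
      fix u assume "u \<in> BH"
      then obtain r y where u: "u = hB r y" "r < R" "y < 2 * m"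
        by (auto simp: BH_def)
      have "u \<in> L (gB r (y div 2))"
        by (cases "even y") (auto simp: u L_gB elim!: evenE oddE)
      moreover have "gB r (y div 2) \<in> BG"
        unfolding BG_def using u by (intro UN_I[of r] imageI) auto
      ultimately show "u \<in> (\<Union>w \<in> BG. L w)"
        by blast
    qed
  qed
  have parity: "2 * i \<noteq> Suc (2 * j)" "Suc (2 * j) \<noteq> 2 * i" for i j :: nat
    by presburger+
  have partB: "indexed_partition L BG BH"
    unfolding indexed_partition_def union_B
    by (auto simp: disjoint_family_on_def BG_def L_gB parity)
  have partAB: "indexed_partition L (AG \<union> BG) (AH \<union> BH)"
  proof -
    have "L v \<inter> L w = {}" if "v \<in> AG" "w \<in> BG" for v w
      using that by (auto simp: AG_def BG_def L_gA L_gB)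
    with partA partB show ?thesis
      unfolding indexed_partition_def disjoint_family_on_def by (simp add: UN_Un) blast
  qed
  have L_sub: "L v \<subseteq> AH" if "v \<in> AG" for v
    using that partA by (auto simp: indexed_partition_def)
  have L_sub': "L w \<subseteq> BH" if "w \<in> BG" for w
    using that partB by (auto simp: indexed_partition_def)
  have no_edge: "edges_between H (L v) (L v') = {}"
    if "v \<in> pverts G" "v' \<in> pverts G" "(v, v') \<notin> parcs G" for v v'
    using that L_sub L_sub' disj E_sub
    by (auto simp: edges_between_def G_def H_def) blast+
  have matching_aux: "is_matching (edges_between H (L (gA v)) (L (gB r j)))"
      "is_matching (edges_between H (L (gB r j)) (L (gA v)))"
    if "v < n" "r < R" "j < m" for v r j
  proof -
    have sub: "edges_between H (L (gA v)) (L (gB r j)) \<subseteq> (\<lambda>x. (hA v x, hB r (p v r x))) ` {..<k}"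
      by (auto simp: edges_between_def H_def E_def L_gA L_gB)
    have sub': "edges_between H (L (gB r j)) (L (gA v)) \<subseteq> (\<lambda>x. (hB r (p v r x), hA v x)) ` {..<k}"
      by (auto simp: edges_between_def H_def E_def L_gA L_gB)
    have "inj_on (hA v) {..<k}" "inj_on (\<lambda>x. hB r (p v r x)) {..<k}"
      "hA v ` {..<k} \<inter> (\<lambda>x. hB r (p v r x)) ` {..<k} = {}"
      using inj[OF that(1,2)] by (auto simp: inj_on_def)
    then show "is_matching (edges_between H (L (gA v)) (L (gB r j)))"
      "is_matching (edges_between H (L (gB r j)) (L (gA v)))"
      using is_matching_image[OF sub] is_matching_image[OF sub'] by (simp_all add: Int_commute)
  qed
  have cover: "bipartite_correspondence_cover G AG BG H AH BH L"
    unfolding bipartite_correspondence_cover_def bipartite_cover_def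
  proof (intro conjI ballI impI)
    show "indexed_partition L (pverts G) (pverts H)"
      using partAB by (simp add: G_def H_def)
    show "case e of (v, v') \<Rightarrow> is_matching (edges_between H (L v) (L v'))" if "e \<in> parcs G" for e
      using that matching_aux by (auto simp: G_def AG_def BG_def)
  qed (use bipG bipH partA partB no_edge in auto)
  have "max_degree_le H D"
    unfolding H_def
  proof (rule max_degree_symmetric_graph[OF disj(2) E_sub])
    fix u assume "u \<in> AH"
    then obtain v x where u: "u = hA v x"
      by (auto simp: AH_def)
    have "E `` {u} \<subseteq> (\<lambda>r. hB r (p v r x)) ` {..<R}"
      by (auto simp: E_def u)
    then have "card (E `` {u}) \<le> R"
      using surj_card_le[of "{..<R}"] by simp
    with \<open>R \<le> D\<close> show "card (E `` {u}) \<le> D"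
      by simp
  next
    fix u assume "u \<in> BH"
    then obtain r y where u: "u = hB r y" "r < R" "y < 2 * m"
      by (auto simp: BH_def)
    let ?V = "{v. v < n \<and> y \<in> p v r ` {..<k}}"
    \<comment> \<open>Injectivity leaves at most one neighbour of the bin in each part.\<close>
    have "E\<inverse> `` {u} \<subseteq> (\<lambda>v. hA v (inv_into {..<k} (p v r) y)) ` ?V"
      using inj u(2) by (auto simp: E_def u(1) intro!: image_eqI)
    then have "card (E\<inverse> `` {u}) \<le> card ?V"
      by (intro surj_card_le) auto
    with load[OF u(2,3)] show "card (E\<inverse> `` {u}) \<le> D"
      by simp
  qed
  moreover have "\<forall>v \<in> AG. card (L v) = k"
    by (auto simp: AG_def L_gA card_image inj_on_def)
  moreover have "\<forall>w \<in> BG. card (L w) = 2"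
    by (auto simp: BG_def L_gB)
  moreover have "\<not> independent_transversal G H L S" for S
  proof
    assume S: "independent_transversal G H L S"
    have "\<exists>x<k. hA v x \<in> S" if "v < n" for v
    proof -
      have "gA v \<in> pverts G"
        using that by (simp add: G_def AG_def)
      then have "\<exists>u. u \<in> S \<inter> L (gA v)"
        using S unfolding independent_transversal_def by blast
      then show ?thesis
        by (auto simp: L_gA)
    qed
    then obtain a where a: "\<And>v. v < n \<Longrightarrow> a v < k" "\<And>v. v < n \<Longrightarrow> hA v (a v) \<in> S"
      by metis
    from collision[of a, OF a(1)] obtain r j v v' where
      *: "r < R" "j < m" "v < n" "v' < n" "p v r (a v) = 2 * j" "p v' r (a v') = 2 * j + 1"
      by blast
    have "gB r j \<in> pverts G"
      using * by (auto simp: G_def BG_def)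
    then have "\<exists>u. u \<in> S \<inter> L (gB r j)"
      using S unfolding independent_transversal_def by blast
    moreover have "(hA v (a v), hB r (2 * j)) \<in> parcs H" "(hA v' (a v'), hB r (2 * j + 1)) \<in> parcs H"
      using * a(1) by (force simp: H_def E_def)+
    ultimately show False
      using S a(2) * by (auto simp: independent_transversal_def independent_set_def L_gB)
  qed
  ultimately show ?thesis
    using cover by blast
qed


section \<open>Throws without collisions\<close>

definition collision_free :: "nat \<Rightarrow> nat \<Rightarrow> (nat \<Rightarrow> nat) set" where
  "collision_free n m = {t \<in> {..<n} \<rightarrow>\<^sub>E {..<2 * m}.
     \<not> (\<exists>j<m. 2 * j \<in> t ` {..<n} \<and> 2 * j + 1 \<in> t ` {..<n})}"

lemma finite_collision_free: "finite (collision_free n m)"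
  by (rule finite_subset[of _ "{..<n} \<rightarrow>\<^sub>E {..<2 * m}"])
     (auto simp: collision_free_def intro!: finite_PiE)

definition partner :: "nat \<Rightarrow> nat" where
  "partner y = (if even y then y + 1 else y - 1)"

lemma partner_partner [simp]: "partner (partner y) = y"
  by (auto simp: partner_def)

lemma inj_partner: "inj partner"
  by (metis injI partner_partner)

lemma partner_less: "y < 2 * m \<Longrightarrow> partner y < 2 * m"
  by (auto simp: partner_def elim!: evenE oddE)

lemma partner_notin_image:
  assumes "t \<in> collision_free n m" "u < n" "v < n"
  shows "t v \<noteq> partner (t u)"
proof
  assume eq: "t v = partner (t u)"
  have "t u < 2 * m" "t v < 2 * m"
    using assms by (auto simp: collision_free_def)
  then obtain j where "j < m" "{2 * j, 2 * j + 1} = {t u, t v}"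
    using eq by (intro that[of "t u div 2"]) (auto simp: partner_def elim!: evenE oddE)
  with assms show False
    unfolding collision_free_def by (auto simp: doubleton_eq_iff)
qed

lemma card_PiE_halves:
  fixes h :: nat
  assumes "finite S" "finite T"
  shows "card (\<Pi>\<^sub>E v\<in>{..<2 * h}. if v < h then S else T) = card S ^ h * card T ^ h"
proof -
  have "(\<Prod>v<2 * h. card (if v < h then S else T)) =
      (\<Prod>v<h. card (if v < h then S else T)) * (\<Prod>v\<in>{h..<2 * h}. card (if v < h then S else T))"
    by (subst prod.union_disjoint[symmetric]) (auto intro!: prod.cong)
  also have "\<dots> = card S ^ h * card T ^ h"
    by (auto intro!: arg_cong2[of _ _ _ _ times])
  finally show ?thesis
    by (simp add: card_PiE)
qed

text \<open>
  The two summands count the throws whose first half occupies fewer than \<open>q\<close> bins, by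
  choosing a set of \<open>q\<close> bins that contains them, and the throws whose first half occupies at least
  \<open>q\<close> bins, where the second half must stay off the partners of these bins.
\<close>
lemma card_collision_free_le:
  assumes "q \<le> 2 * m"
  shows "card (collision_free (2 * h) m) \<le>
    (2 * m) ^ h * ((2 * m) ^ q * q ^ h + (2 * m - q) ^ h)"
proof -
  let ?k = "2 * m"
  let ?F = "{..<h} \<rightarrow>\<^sub>E {..<?k}"
  let ?few = "\<lambda>S. \<Pi>\<^sub>E v\<in>{..<2 * h}. if v < h then S else {..<?k}"
  let ?many = "\<lambda>f. \<Pi>\<^sub>E v\<in>{..<2 * h}. if v < h then {f v} else {..<?k} - partner ` f ` {..<h}"
  let ?S = "{S. S \<subseteq> {..<?k} \<and> card S = q}"
  let ?M = "{f \<in> ?F. q \<le> card (f ` {..<h})}"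
  have "collision_free (2 * h) m \<subseteq> (\<Union>S\<in>?S. ?few S) \<union> (\<Union>f\<in>?M. ?many f)"
  proof
    fix t assume t: "t \<in> collision_free (2 * h) m"
    then have range: "t v < ?k" if "v < 2 * h" for v
      using that by (auto simp: collision_free_def)
    have ext: "t \<in> extensional {..<2 * h}"
      using t by (auto simp: collision_free_def PiE_def)
    let ?f = "restrict t {..<h}"
    have f: "?f \<in> ?F" "?f ` {..<h} = t ` {..<h}"
      using range by auto
    show "t \<in> (\<Union>S\<in>?S. ?few S) \<union> (\<Union>f\<in>?M. ?many f)"
    proof (cases "q \<le> card (t ` {..<h})")
      case True
      then have "?f \<in> ?M"
        using f by auto
      moreover have "t \<in> ?many ?f"
        using range ext partner_notin_image[OF t] by (auto simp: PiE_def)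
      ultimately show ?thesis
        by blast
    next
      case False
      have "t ` {..<h} \<subseteq> {..<?k}"
        using range by auto
      then obtain S where "t ` {..<h} \<subseteq> S" "S \<subseteq> {..<?k}" "card S = q"
        using exists_subset_between[of "t ` {..<h}" q "{..<?k}"] False assms by auto
      moreover from this have "t \<in> ?few S"
        using range ext by (auto simp: PiE_def image_subset_iff)
      ultimately show ?thesis
        by blast
    qed
  qed
  moreover have "finite ((\<Union>S\<in>?S. ?few S) \<union> (\<Union>f\<in>?M. ?many f))"
    by (auto intro!: finite_PiE finite_subset[of ?M ?F] intro: finite_subset[of _ "{..<?k}"])
  ultimately have "card (collision_free (2 * h) m) \<le> card ((\<Union>S\<in>?S. ?few S) \<union> (\<Union>f\<in>?M. ?many f))"
    by (rule card_mono[rotated])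
  also have "\<dots> \<le> card (\<Union>S\<in>?S. ?few S) + card (\<Union>f\<in>?M. ?many f)"
    by (rule card_Un_le)
  also have "card (\<Union>S\<in>?S. ?few S) \<le> (\<Sum>S\<in>?S. q ^ h * ?k ^ h)"
  proof (intro order.trans[OF card_UN_le] sum_mono)
    show "card (?few S) \<le> q ^ h * ?k ^ h" if "S \<in> ?S" for S
      using that by (subst card_PiE_halves) (auto intro: finite_subset[of _ "{..<?k}"])
  qed simp
  also have "\<dots> \<le> ?k ^ q * (q ^ h * ?k ^ h)"
    using n_subsets[of "{..<?k}" q] binomial_le_pow[OF assms] by (simp del: mult_le_cancel2)
  also have "card (\<Union>f\<in>?M. ?many f) \<le> (\<Sum>f\<in>?M. (?k - q) ^ h)"
  proof (intro order.trans[OF card_UN_le] sum_mono)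
    show "finite ?M"
      by (auto intro!: finite_subset[of ?M ?F] finite_PiE)
    fix f assume f: "f \<in> ?M"
    let ?P = "partner ` f ` {..<h}"
    have "?P \<subseteq> {..<?k}"
      using f partner_less by auto
    moreover have "q \<le> card ?P"
      using f by (simp add: card_image inj_on_subset[OF inj_partner])
    ultimately have P: "card ({..<?k} - ?P) \<le> ?k - q"
      by (simp add: card_Diff_subset)
    have "card (?many f) = (\<Prod>v\<in>{..<h} \<union> {h..<2 * h}. card (if v < h then {f v} else {..<?k} - ?P))"
      by (subst card_PiE) (auto intro!: prod.cong)
    also have "\<dots> = card ({..<?k} - ?P) ^ h"
      by (subst prod.union_disjoint) auto
    finally show "card (?many f) \<le> (?k - q) ^ h"
      using P by (simp add: power_mono)
  qed
  also have "(\<Sum>f\<in>?M. (?k - q) ^ h) \<le> ?k ^ h * (?k - q) ^ h"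
  proof -
    have "card ?M \<le> card ?F"
      by (intro card_mono finite_PiE) auto
    then show ?thesis
      by (simp add: card_PiE)
  qed
  finally show ?thesis
    by (simp add: algebra_simps)
qed


section \<open>Random shifts\<close>

lemma mod_shift_inject:
  fixes c x y k :: nat
  assumes "(c + x) mod k = (c + y) mod k" "x < k" "y < k"
  shows "x = y"
proof -
  have "(int c + int x) mod int k = (int c + int y) mod int k"
    using assms(1) by (metis of_nat_add of_nat_mod)
  then have "int k dvd int x - int y"
    by (simp add: mod_eq_dvd_iff)
  with assms(2,3) show ?thesis
    using zdvd_imp_le[of "int k" "int x - int y"] zdvd_imp_le[of "int k" "int y - int x"]
    by (cases x y rule: linorder_cases) (auto simp: dvd_diff_commute)
qed

text \<open>
  The union bound, phrased as counting. For fixed \<open>a\<close>, adding \<open>a\<close> permutes the throws of one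
  round, so at most \<open>N\<^sup>n\<close> families of shifts avoid all collisions, where \<open>N\<close> is the number of
  collision-free throws. Summing over the \<open>(2 m)\<^sup>n\<close> choices of \<open>a\<close> gives at most
  \<open>(2 m N)\<^sup>n\<close> failing families, out of \<open>((2 m)\<^sup>n)\<^sup>n\<close>. Having as many rounds as parts is what lets
  the two sides be compared through their \<open>n\<close>-th roots.
\<close>
lemma exists_colliding_shifts:
  assumes "m \<ge> 1" and few: "2 * m * card (collision_free n m) < (2 * m) ^ n"
  obtains s :: "nat \<Rightarrow> nat \<Rightarrow> nat" where
    "\<And>a. (\<And>v. v < n \<Longrightarrow> a v < 2 * m) \<Longrightarrow> \<exists>r<n. \<exists>j<m. \<exists>v<n. \<exists>v'<n.
      (s r v + a v) mod (2 * m) = 2 * j \<and> (s r v' + a v') mod (2 * m) = 2 * j + 1"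
proof -
  let ?k = "2 * m" and ?C = "collision_free n m"
  let ?T = "{..<n} \<rightarrow>\<^sub>E {..<?k}"
  let ?\<Sigma> = "{..<n} \<rightarrow>\<^sub>E ?T"
  define shift where "shift a t = (\<lambda>v\<in>{..<n}. (a v + t v) mod ?k)" for a t :: "nat \<Rightarrow> nat"
  define bad where "bad a = {s \<in> ?\<Sigma>. \<forall>r<n. shift a (s r) \<in> ?C}" for a
  have "n > 0"
  proof (rule ccontr)
    assume "\<not> n > 0"
    then have "?C = {\<lambda>_. undefined}"
      by (auto simp: collision_free_def)
    with few \<open>\<not> n > 0\<close> \<open>m \<ge> 1\<close> show False
      by simp
  qed
  have fin_T: "finite ?T" and fin_\<Sigma>: "finite ?\<Sigma>"
    by (intro finite_PiE; simp)+
  have card_bad: "card (bad a) \<le> card ?C ^ n" for a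
  proof -
    let ?N = "{t \<in> ?T. shift a t \<in> ?C}"
    have "inj_on (shift a) ?T"
    proof (intro inj_onI PiE_ext)
      fix t t' v
      assume t: "t \<in> ?T" "t' \<in> ?T" and eq: "shift a t = shift a t'" and v: "v \<in> {..<n}"
      from fun_cong[OF eq, of v] v have "(a v + t v) mod ?k = (a v + t' v) mod ?k"
        by (simp add: shift_def)
      moreover have "t v < ?k" "t' v < ?k"
        using t v by auto
      ultimately show "t v = t' v"
        by (rule mod_shift_inject)
    qed auto
    then have "inj_on (shift a) ?N"
      by (rule inj_on_subset) auto
    then have N: "card ?N \<le> card ?C"
      by (rule card_inj_on_le) (auto simp: finite_collision_free)
    have "bad a \<subseteq> {..<n} \<rightarrow>\<^sub>E ?N"
      by (simp add: bad_def PiE_iff subset_iff)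
    then have "card (bad a) \<le> card ({..<n} \<rightarrow>\<^sub>E ?N)"
      using fin_T by (intro card_mono finite_PiE) auto
    also have "\<dots> \<le> card ?C ^ n"
      using N by (simp add: card_PiE power_mono)
    finally show ?thesis .
  qed
  have "card (\<Union>a\<in>?T. bad a) \<le> (\<Sum>a\<in>?T. card ?C ^ n)"
    by (rule order.trans[OF card_UN_le[OF fin_T] sum_mono[OF card_bad]])
  also have "\<dots> = (?k * card ?C) ^ n"
    by (simp add: card_PiE power_mult_distrib)
  also have "\<dots> < (?k ^ n) ^ n"
    using few \<open>n > 0\<close> by (intro power_strict_mono) auto
  also have "\<dots> = card ?\<Sigma>"
    by (simp add: card_PiE)
  finally have "card (\<Union>a\<in>?T. bad a) < card ?\<Sigma>" .
  moreover have "finite (\<Union>a\<in>?T. bad a)"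
    using fin_\<Sigma> by (rule finite_subset[rotated]) (auto simp: bad_def)
  ultimately have "\<not> ?\<Sigma> \<subseteq> (\<Union>a\<in>?T. bad a)"
    using card_mono by (meson not_le)
  then obtain s where s: "s \<in> ?\<Sigma>" "\<And>a. a \<in> ?T \<Longrightarrow> s \<notin> bad a"
    by blast
  show thesis
  proof (rule that[of s])
    fix a :: "nat \<Rightarrow> nat" assume a: "\<And>v. v < n \<Longrightarrow> a v < ?k"
    have "s \<notin> bad (restrict a {..<n})"
      using a by (intro s(2)) auto
    then obtain r where r: "r < n" "shift (restrict a {..<n}) (s r) \<notin> ?C"
      using s(1) by (auto simp: bad_def)
    let ?t = "shift (restrict a {..<n}) (s r)"
    have "?t \<in> ?T"
      using \<open>m \<ge> 1\<close> by (auto simp: shift_def)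
    with r(2) obtain j where "j < m" "2 * j \<in> ?t ` {..<n}" "2 * j + 1 \<in> ?t ` {..<n}"
      by (auto simp: collision_free_def)
    then obtain v v' where v: "v < n" "v' < n" "?t v = 2 * j" "?t v' = 2 * j + 1"
      by (metis (no_types, lifting) imageE lessThan_iff)
    then have "(s r v + a v) mod ?k = 2 * j" "(s r v' + a v') mod ?k = 2 * j + 1"
      by (simp_all add: shift_def add.commute)
    with r(1) \<open>j < m\<close> v(1,2) show "\<exists>r<n. \<exists>j<m. \<exists>v<n. \<exists>v'<n.
        (s r v + a v) mod ?k = 2 * j \<and> (s r v' + a v') mod ?k = 2 * j + 1"
      by blast
  qed
qed

section \<open>The choice of parameters\<close>

text \<open>
  In terms of probabilities, both contributions of \<open>card_collision_free_le\<close> have to be at most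
  \<open>1 / (2 k)\<close>. The first is at most \<open>k\<^sup>q (q / k)\<^sup>h\<close>, tiny because \<open>k \<le> (k / q)\<^sup>2\<close>
  and \<open>h = s q\<close> is well above \<open>2 q\<close>; the second is at most \<open>exp (- s / 2)\<close>, which the assumption compares with
  \<open>1 / (2 k) = 1 / (4 s\<^sup>8)\<close>.
\<close>
lemma few_collision_free:
  fixes s :: nat
  assumes "s \<ge> 3" and large: "4 * real s ^ 8 \<le> exp (real s / 2)"
  shows "2 * s ^ 8 * card (collision_free (2 * s ^ 5) (s ^ 8)) < (2 * s ^ 8) ^ (2 * s ^ 5)"
proof -
  define h q b k where "h = s ^ 5" and "q = s ^ 4" and "b = 2 * s ^ 4" and "k = 2 * s ^ 8"
  have k: "k = b * q"
    by (simp add: k_def b_def q_def power_add[symmetric])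
  have "s > 0"
    using assms(1) by simp
  then have pos: "q \<ge> 1" "b \<ge> 2" "k \<ge> 1"
    by (simp_all add: q_def b_def k_def)
  \<comment> \<open>After cancelling \<open>q ^ h\<close>, both sides compare with powers of \<open>b = k / q\<close>.\<close>
  have "2 * (k * (k ^ q * q ^ h)) < k ^ h"
  proof -
    have "k \<le> b ^ 2"
      by (simp add: k power2_eq_square b_def q_def)
    then have "2 * (k * k ^ q) \<le> b * (b ^ 2 * (b ^ 2) ^ q)"
      using pos by (intro mult_mono power_mono) auto
    also have "\<dots> = b ^ (2 * q + 3)"
      by (simp add: power_mult power_add power2_eq_square power3_eq_cube)
    also have "\<dots> < b ^ h"
    proof (rule power_strict_increasing)
      have "3 < (3 :: nat) ^ 4" by simp
      also have "3 ^ 4 \<le> q"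
        unfolding q_def using assms(1) by (intro power_mono) auto
      finally have "2 * q + 3 < 3 * q"
        by simp
      also have "3 * q \<le> h"
        using mult_right_mono[OF assms(1), of q] by (simp add: q_def h_def flip: power_Suc)
      finally show "2 * q + 3 < h" .
    qed (use pos in simp)
    finally have "2 * (k * k ^ q) * q ^ h < b ^ h * q ^ h"
      using pos by simp
    then show ?thesis
      by (simp add: k power_mult_distrib mult_ac)
  qed
  moreover have "2 * (k * (k - q) ^ h) \<le> k ^ h"
  proof -
    have "real (k - q) = real k * (1 - 1 / b)"
      using pos by (simp add: k of_nat_diff field_simps)
    also have "\<dots> \<le> real k * exp (- 1 / b)"
      using exp_ge_add_one_self[of "- 1 / b"] by (intro mult_left_mono) auto
    finally have "real (k - q) ^ h \<le> (real k * exp (- 1 / b)) ^ h"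
      by (rule power_mono) simp
    also have "\<dots> = real k ^ h * exp (- (real s / 2))"
      using \<open>s > 0\<close>
      by (simp add: power_mult_distrib exp_of_nat_mult[symmetric] b_def h_def field_simps flip: power_Suc)
    finally have "real (2 * k) * real (k - q) ^ h \<le> real (2 * k) * (real k ^ h * exp (- (real s / 2)))"
      by (rule mult_left_mono) simp
    also have "\<dots> = (4 * real s ^ 8) * exp (- (real s / 2)) * real k ^ h"
      by (simp add: k_def)
    also have "\<dots> \<le> exp (real s / 2) * exp (- (real s / 2)) * real k ^ h"
      using large by (intro mult_right_mono) auto
    also have "\<dots> = real k ^ h"
      by (simp add: exp_minus)
    finally have "real (2 * (k * (k - q) ^ h)) \<le> real (k ^ h)"
      by (simp add: mult_ac)
    then show ?thesis
      by (simp only: of_nat_le_iff)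
  qed
  ultimately have "k * (k ^ q * q ^ h + (k - q) ^ h) < k ^ h"
    by (simp add: algebra_simps)
  then have less: "k ^ h * (k * (k ^ q * q ^ h + (k - q) ^ h)) < k ^ h * k ^ h"
    using pos by simp
  have "card (collision_free (2 * h) (s ^ 8)) \<le> k ^ h * (k ^ q * q ^ h + (k - q) ^ h)"
    using card_collision_free_le[of q "s ^ 8" h] pos by (simp add: k_def[symmetric] k)
  then have "k * card (collision_free (2 * h) (s ^ 8)) \<le> k * (k ^ h * (k ^ q * q ^ h + (k - q) ^ h))"
    by (rule mult_le_mono2)
  also have "\<dots> = k ^ h * (k * (k ^ q * q ^ h + (k - q) ^ h))"
    by (rule mult.left_commute)
  also note less
  also have "k ^ h * k ^ h = k ^ (2 * h)"
    by (simp add: mult_2 power_add)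
  finally have "k * card (collision_free (2 * h) (s ^ 8)) < k ^ (2 * h)" .
  then show ?thesis
    by (simp add: k_def h_def)
qed

theorem proposition13:
  shows "\<exists>c::real. c > 0 \<and>
    (\<forall>D::nat. D \<ge> 1 \<longrightarrow>
      (\<exists>(G :: nat pair_pre_digraph) A\<^sub>G B\<^sub>G (H :: nat pair_pre_digraph) A\<^sub>H B\<^sub>H (L :: nat \<Rightarrow> nat set).
         bipartite_correspondence_cover G A\<^sub>G B\<^sub>G H A\<^sub>H B\<^sub>H L \<and>
         max_degree_le H D \<and>
         (\<forall>v \<in> A\<^sub>G. real (card (L v)) \<ge> c * real D powr (8 / 5)) \<and>
         (\<forall>w \<in> B\<^sub>G. card (L w) = 2) \<and>
         \<not> (\<exists>S. independent_transversal G H L S)))"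
proof -
  have "eventually (\<lambda>s :: nat. 4 * real s ^ 8 \<le> exp (real s / 2)) at_top"
    by real_asymp
  then obtain s\<^sub>0 where s\<^sub>0: "\<And>s. s \<ge> s\<^sub>0 \<Longrightarrow> 4 * real s ^ 8 \<le> exp (real s / 2)"
    by (auto simp: eventually_at_top_linorder)
  define s\<^sub>1 where "s\<^sub>1 = max s\<^sub>0 3"
  \<comment> \<open>The first bound on \<open>c\<close> serves large \<open>D\<close>, where \<open>D \<le> (4 s)\<^sup>5\<close>. The second makes the required list
    size at most one for small \<open>D\<close>.\<close>
  define c :: real where "c = min (1 / 4 ^ 8) (1 / real (2 * s\<^sub>1 ^ 5) powr (8 / 5))"
  have main: "\<exists>(G :: nat pair_pre_digraph) A\<^sub>G B\<^sub>G (H :: nat pair_pre_digraph) A\<^sub>H B\<^sub>H L k.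
      bipartite_correspondence_cover G A\<^sub>G B\<^sub>G H A\<^sub>H B\<^sub>H L \<and> max_degree_le H D \<and>
      (\<forall>v \<in> A\<^sub>G. card (L v) = k) \<and> (\<forall>w \<in> B\<^sub>G. card (L w) = 2) \<and>
      \<not> (\<exists>S. independent_transversal G H L S) \<and> c * real D powr (8 / 5) \<le> real k"
    if "D \<ge> 1" for D :: nat
  proof (cases "D < 2 * s\<^sub>1 ^ 5")
    case True
    have "real D \<le> real (2 * s\<^sub>1 ^ 5)"
      using True by (simp only: of_nat_le_iff less_imp_le)
    then have "c * real D powr (8 / 5) \<le> 1 / real (2 * s\<^sub>1 ^ 5) powr (8 / 5) * real (2 * s\<^sub>1 ^ 5) powr (8 / 5)"
      by (intro mult_mono powr_mono2) (auto simp: c_def)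
    also have "\<dots> \<le> real 1"
      by simp
    finally have "c * real D powr (8 / 5) \<le> real 1" .
    \<comment> \<open>A single pair of bins, each joined to the only element of one of two lists.\<close>
    moreover have "\<exists>(G :: nat pair_pre_digraph) A\<^sub>G B\<^sub>G (H :: nat pair_pre_digraph) A\<^sub>H B\<^sub>H L.
      bipartite_correspondence_cover G A\<^sub>G B\<^sub>G H A\<^sub>H B\<^sub>H L \<and> max_degree_le H D \<and>
      (\<forall>v \<in> A\<^sub>G. card (L v) = 1) \<and> (\<forall>w \<in> B\<^sub>G. card (L w) = 2) \<and>
      \<not> (\<exists>S. independent_transversal G H L S)"
    proof (rule cover_of_placement[of 1 1 D 2 "\<lambda>v r x. v" 1])
      show "card {v. v < 2 \<and> y \<in> (\<lambda>x. v) ` {..<1 :: nat}} \<le> D" for y :: nat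
      proof -
        have "{v. v < 2 \<and> y \<in> (\<lambda>x. v) ` {..<1 :: nat}} \<subseteq> {y}"
          by auto
        from card_mono[OF _ this] that show ?thesis
          by simp
      qed
      show "\<exists>r<1 :: nat. \<exists>j<1 :: nat. \<exists>v<2 :: nat. \<exists>v'<2 :: nat. v = 2 * j \<and> v' = 2 * j + 1"
        by simp
    qed (use that in \<open>auto simp: inj_on_def\<close>)
    ultimately show ?thesis
      by blast
  next
    case False
    define s where "s = Max {s. 2 * s ^ 5 \<le> D}"
    have fin: "finite {s. 2 * s ^ 5 \<le> D}"
    proof (rule finite_subset)
      have "s \<le> 2 * s ^ 5" for s :: nat
        using self_le_power[of s 5] by (cases "s = 0") simp_all
      then show "{s. 2 * s ^ 5 \<le> D} \<subseteq> {..D}"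
        by (auto intro: order.trans)
    qed simp
    have max: "s' \<le> s" if "2 * s' ^ 5 \<le> D" for s'
      unfolding s_def using fin that by (intro Max_ge) auto
    have "s \<in> {s. 2 * s ^ 5 \<le> D}"
      unfolding s_def using fin False by (intro Max_in) (auto simp: not_less)
    then have s: "2 * s ^ 5 \<le> D" "s\<^sub>1 \<le> s"
      using max False by auto
    have "D < 2 * (s + 1) ^ 5"
      using max[of "s + 1"] by (cases "2 * (s + 1) ^ 5 \<le> D") auto
    have "s \<ge> 3" "s \<ge> s\<^sub>0"
      using s(2) by (auto simp: s\<^sub>1_def)
    let ?k = "2 * s ^ 8" and ?n = "2 * s ^ 5"
    have "D \<le> (4 * s) ^ 5"
    proof -
      have "2 * (s + 1) ^ 5 \<le> 2 * (2 * s) ^ 5"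
        using \<open>s \<ge> 3\<close> by (intro mult_left_mono power_mono) auto
      also have "\<dots> \<le> (4 * s) ^ 5"
        by (simp add: power_mult_distrib)
      finally show ?thesis
        using \<open>D < 2 * (s + 1) ^ 5\<close> by simp
    qed
    then have "real D \<le> real (4 * s) ^ 5"
      by (metis of_nat_le_iff of_nat_power)
    then have "real D powr (8 / 5) \<le> (real (4 * s) powr 5) powr (8 / 5)"
      using \<open>s \<ge> 3\<close> by (intro powr_mono2) (auto simp: powr_numeral)
    also have "\<dots> = real (4 * s) powr 8"
      by (simp only: powr_powr) simp
    also have "\<dots> = 4 ^ 8 * real s ^ 8"
      using \<open>s \<ge> 3\<close> by (simp add: powr_numeral power_mult_distrib)
    finally have "c * real D powr (8 / 5) \<le> 1 / 4 ^ 8 * (4 ^ 8 * real s ^ 8)"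
      by (intro mult_mono) (auto simp: c_def)
    also have "\<dots> \<le> real ?k"
      by simp
    finally have "c * real D powr (8 / 5) \<le> real ?k" .
    moreover
    have "s ^ 8 \<ge> 1"
      using \<open>s \<ge> 3\<close> by simp
    with few_collision_free[OF \<open>s \<ge> 3\<close> s\<^sub>0[OF \<open>s \<ge> s\<^sub>0\<close>]] obtain \<sigma> :: "nat \<Rightarrow> nat \<Rightarrow> nat" where
      \<sigma>: "\<And>a. (\<And>v. v < ?n \<Longrightarrow> a v < ?k) \<Longrightarrow> \<exists>r<?n. \<exists>j<s ^ 8. \<exists>v<?n. \<exists>v'<?n.
        (\<sigma> r v + a v) mod ?k = 2 * j \<and> (\<sigma> r v' + a v') mod ?k = 2 * j + 1"
      using exists_colliding_shifts[of "s ^ 8" ?n] by blast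
    have "\<exists>(G :: nat pair_pre_digraph) A\<^sub>G B\<^sub>G (H :: nat pair_pre_digraph) A\<^sub>H B\<^sub>H L.
      bipartite_correspondence_cover G A\<^sub>G B\<^sub>G H A\<^sub>H B\<^sub>H L \<and> max_degree_le H D \<and>
      (\<forall>v \<in> A\<^sub>G. card (L v) = ?k) \<and> (\<forall>w \<in> B\<^sub>G. card (L w) = 2) \<and>
      \<not> (\<exists>S. independent_transversal G H L S)"
    proof (rule cover_of_placement[of ?k ?n D ?n "\<lambda>v r x. (\<sigma> r v + x) mod ?k" "s ^ 8"])
      show "inj_on (\<lambda>x. (\<sigma> r v + x) mod ?k) {..<?k}" for v r
        by (rule inj_onI) (blast intro: mod_shift_inject)
      show "card {v. v < ?n \<and> y \<in> (\<lambda>x. (\<sigma> r v + x) mod ?k) ` {..<?k}} \<le> D" for r y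
        using card_mono[of "{..<?n}" "{v. v < ?n \<and> y \<in> (\<lambda>x. (\<sigma> r v + x) mod ?k) ` {..<?k}}"] s(1)
        by fastforce
      show "(\<sigma> r v + x) mod ?k < ?k" for r v x
        using \<open>s \<ge> 3\<close> by simp
    qed (use \<open>s ^ 8 \<ge> 1\<close> s(1) \<sigma> in auto)
    ultimately show ?thesis
      by blast
  qed
  have "s\<^sub>1 > 0"
    by (simp add: s\<^sub>1_def)
  then have "c > 0"
    by (simp add: c_def)
  with main show ?thesis
    by metis
qed

end
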